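(* Let $p$ and $q$ be any positive integers, let $\alpha\in[0,1]$, and let $c\ge 0$, $\tau\ge 0$, $\beta\ge 0$. Let $(u_h,v_h)$, with $u_h(\cdot,t)\in V_h^p$ and $v_h(\cdot,t)\in V_h^q$, be a solution of the one-dimensional semi-discrete OF-EDG scheme described in the context, with numerical fluxes $\widehat v,\widehat{u_x}$ given by the parameters $\alpha,\tau,\beta$ and with periodic boundary conditions. Then the discrete energy $$\mathbb{E}_h(t)=\int_{\Omega}\big((u_h)_x^2+(v_h)^2\big)\,dx=\sum_{j=1}^N\int_{I_j}\big((u_h)_x^2+(v_h)^2\big)\,dx,\qquad \Omega=(a,b),$$ satisfies $$\frac{d\,\mathbb{E}_h}{dt}\le 0 .$$
   Context: The scheme discretizes $u_{tt}=u_{xx}$ on $(a,b)\times(0,T]$ with periodic boundary conditions, written as $u_t=v$, $v_t=u_{xx}$. Mesh: $a=x_{1/2}<x_{3/2}<\dots<x_{N+1/2}=b$, $I_j=[x_{j-1/2},x_{j+1/2}]$, $h_j=x_{j+1/2}-x_{j-1/2}$, $h=\max_j h_j$. $V_h^k=\{w\in L^2([a,b]): w|_{I_j}\in P^k(I_j),\ j=1,\dots,N\}$, where $P^k(I_j)$ is the space of polynomials of degree at most $k$ on $I_j$. Spatial derivatives of functions in $V_h^k$ are taken cell by cell. $w|^{\pm}_{j+1/2}=\lim_{\epsilon\to0^+}w(x_{j+1/2}\pm\epsilon)$ and $[\![w]\!]_{j+1/2}=w|^+_{j+1/2}-w|^-_{j+1/2}$. Periodic boundary conditions mean that $x_{1/2}$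 and $x_{N+1/2}$ are identified when taking traces, jumps and fluxes. Numerical fluxes, at each interface: $\widehat v=\alpha v_h^++(1-\alpha)v_h^-+\tau[\![(u_h)_x]\!]$ and $\widehat{u_x}=(1-\alpha)(u_h)_x^++\alpha(u_h)_x^-+\beta[\![v_h]\!]$. $\mathbb{P}^l$ ($l\ge0$) is the local $L^2$ projection onto $V_h^l$: $\int_{I_j}(\mathbb{P}^lw-w)\phi\,dx=0$ for all $\phi\in P^l(I_j)$ and all $j$; by convention $\mathbb{P}^{-1}=\mathbb{P}^0$. Damping coefficients: $$\sigma_j^l=\frac{2(2l+1)}{2p-1}\frac{h_j^l}{l!}\big([\![\partial_x^lu_h]\!]^2_{j+1/2}+[\![\partial_x^lu_h]\!]^2_{j-1/2}\big)^{1/2}\ (l\ge1),$$ $$\tilde\sigma_j^l=\frac{2(2l+1)}{2q-1}\frac{h_j^{l+1}}{l!}\big([\![\partial_x^lv_h]\!]^2_{j+1/2}+[\![\partial_x^lv_h]\!]^2_{j-1/2}\big)^{1/2}\ (l\ge0).$$ OF-EDG scheme: $u_h(\cdot,t)\in V_h^p$ and $v_h(\cdot,t)\in V_h^q$ (differentiable in $t$) satisfy, for every $j=1,\dots,N$, all $\phi^{(u)}\in P^p(I_j)$, all $\phi^{(v)}\in P^q(I_j)$ and all times $t$: $$\int_{I_j}\big((u_h)_t-v_h\big)dx=0,$$ $$\begin{aligned}\int_{I_j}\big((u_h)_t-v_h\big)_x\phi^{(u)}_x\,dx=&\big(\widehat v_{j+1/2}-v_h|^-_{j+1/2}\big)\phi^{(u)}_x|^-_{j+1/2}-\big(\widehat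 v_{j-1/2}-v_h|^+_{j-1/2}\big)\phi^{(u)}_x|^+_{j-1/2}\\&+\frac{c}{h^2}\big([\![u_h]\!]_{j+1/2}\phi^{(u)}|^-_{j+1/2}-[\![u_h]\!]_{j-1/2}\phi^{(u)}|^+_{j-1/2}\big)\\&-\sum_{l=1}^p\frac{\sigma_j^l}{h_j}\int_{I_j}\big((u_h)_x-\mathbb{P}^{l-1}(u_h)_x\big)\phi^{(u)}_x\,dx,\end{aligned}$$ $$\begin{aligned}\int_{I_j}\big((v_h)_t\phi^{(v)}+(u_h)_x\phi^{(v)}_x\big)dx=&\widehat{u_x}|_{j+1/2}\phi^{(v)}|^-_{j+1/2}-\widehat{u_x}|_{j-1/2}\phi^{(v)}|^+_{j-1/2}\\&-\sum_{l=0}^q\frac{\tilde\sigma_j^l}{h_j}\int_{I_j}\big(v_h-\mathbb{P}^{l-1}v_h\big)\phi^{(v)}\,dx.\end{aligned}$$ *)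

theory Defs
  imports "HOL-Analysis.Analysis" "HOL-Computational_Algebra.Polynomial"
begin

text \<open>
  The interface \<open>x\<^bsub>i+1/2\<^esub>\<close> is \<open>X i\<close> for \<open>i = 0, \<dots>, N\<close>, so that the cell \<open>I\<^sub>j\<close>
  is \<open>{X (j - 1)..X j}\<close> for \<open>j = 1, \<dots>, N\<close>.
\<close>

definition mesh :: "real \<Rightarrow> real \<Rightarrow> nat \<Rightarrow> (nat \<Rightarrow> real) \<Rightarrow> bool" where
  "mesh a b N X \<longleftrightarrow> N \<ge> 1 \<and> X 0 = a \<and> X N = b \<and> (\<forall>j\<in>{1..N}. X (j - 1) < X j)"

definition cell :: "(nat \<Rightarrow> real) \<Rightarrow> nat \<Rightarrow> real set" where
  "cell X j = {X (j - 1)..X j}"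

definition cell_size :: "(nat \<Rightarrow> real) \<Rightarrow> nat \<Rightarrow> real" where
  "cell_size X j = X j - X (j - 1)"

definition mesh_size :: "nat \<Rightarrow> (nat \<Rightarrow> real) \<Rightarrow> real" where
  "mesh_size N X = Max (cell_size X ` {1..N})"

text \<open>
  Elements of \<open>V\<^sub>h\<^sup>k\<close> are \<open>L\<^sup>2\<close> functions; we use representatives that agree with a
  polynomial on the interior of every cell. The values at the interfaces are arbitrary; below,
  they enter only through integrals (where they do not matter) and one-sided limits.
  For the same reason the cell-by-cell spatial derivative is the pointwise \<^const>\<open>deriv\<close>:
  the two agree in the interior of every cell.
\<close>

definition Vh :: "nat \<Rightarrow> (nat \<Rightarrow> real) \<Rightarrow> nat \<Rightarrow> (real \<Rightarrow> real) set" where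
  "Vh N X k = {w. \<forall>j\<in>{1..N}. \<exists>P. degree P \<le> k \<and> (\<forall>y\<in>interior (cell X j). w y = poly P y)}"

text \<open>One-sided traces at the interface \<open>i\<close>; the interfaces \<open>0\<close> and \<open>N\<close> are identified.\<close>

definition trace_minus :: "nat \<Rightarrow> (nat \<Rightarrow> real) \<Rightarrow> (real \<Rightarrow> real) \<Rightarrow> nat \<Rightarrow> real" where
  "trace_minus N X w i = Lim (at_left (X (if i = 0 then N else i))) w"

definition trace_plus :: "nat \<Rightarrow> (nat \<Rightarrow> real) \<Rightarrow> (real \<Rightarrow> real) \<Rightarrow> nat \<Rightarrow> real" where
  "trace_plus N X w i = Lim (at_right (X (if i = N then 0 else i))) w"

definition jump :: "nat \<Rightarrow> (nat \<Rightarrow> real) \<Rightarrow> (real \<Rightarrow> real) \<Rightarrow> nat \<Rightarrow> real" where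
  "jump N X w i = trace_plus N X w i - trace_minus N X w i"

definition flux_v ::
  "nat \<Rightarrow> (nat \<Rightarrow> real) \<Rightarrow> real \<Rightarrow> real \<Rightarrow> (real \<Rightarrow> real) \<Rightarrow> (real \<Rightarrow> real) \<Rightarrow> nat \<Rightarrow> real" where
  "flux_v N X \<alpha> \<tau> u v i =
     \<alpha> * trace_plus N X v i + (1 - \<alpha>) * trace_minus N X v i + \<tau> * jump N X (deriv u) i"

definition flux_ux ::
  "nat \<Rightarrow> (nat \<Rightarrow> real) \<Rightarrow> real \<Rightarrow> real \<Rightarrow> (real \<Rightarrow> real) \<Rightarrow> (real \<Rightarrow> real) \<Rightarrow> nat \<Rightarrow> real" where
  "flux_ux N X \<alpha> \<beta> u v i =
     (1 - \<alpha>) * trace_plus N X (deriv u) i + \<alpha> * trace_minus N X (deriv u) i + \<beta> * jump N X v i"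

text \<open>The projection is unique up to its values at the interfaces.\<close>

definition L2_proj :: "nat \<Rightarrow> (nat \<Rightarrow> real) \<Rightarrow> nat \<Rightarrow> (real \<Rightarrow> real) \<Rightarrow> real \<Rightarrow> real" where
  "L2_proj N X l w = (SOME z. z \<in> Vh N X l \<and>
     (\<forall>j\<in>{1..N}. \<forall>\<phi>. degree \<phi> \<le> l \<longrightarrow>
        integral (cell X j) (\<lambda>y. (z y - w y) * poly \<phi> y) = 0))"

definition sigma :: "nat \<Rightarrow> (nat \<Rightarrow> real) \<Rightarrow> nat \<Rightarrow> (real \<Rightarrow> real) \<Rightarrow> nat \<Rightarrow> nat \<Rightarrow> real" where
  "sigma N X p u l j =
     2 * (2 * real l + 1) / (2 * real p - 1) * (cell_size X j ^ l / fact l) *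
     sqrt ((jump N X ((deriv ^^ l) u) j)\<^sup>2 + (jump N X ((deriv ^^ l) u) (j - 1))\<^sup>2)"

definition sigma_tilde :: "nat \<Rightarrow> (nat \<Rightarrow> real) \<Rightarrow> nat \<Rightarrow> (real \<Rightarrow> real) \<Rightarrow> nat \<Rightarrow> nat \<Rightarrow> real" where
  "sigma_tilde N X q v l j =
     2 * (2 * real l + 1) / (2 * real q - 1) * (cell_size X j ^ (l + 1) / fact l) *
     sqrt ((jump N X ((deriv ^^ l) v) j)\<^sup>2 + (jump N X ((deriv ^^ l) v) (j - 1))\<^sup>2)"

text \<open>
  Space-time functions are curried as \<open>w t x\<close>, so \<open>w t\<close> is \<open>w(\<cdot>, t)\<close>.
  The time interval is \<open>(0, T]\<close>; the time derivative at \<open>T\<close> is one-sided.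
\<close>

definition time_deriv :: "real \<Rightarrow> (real \<Rightarrow> real \<Rightarrow> real) \<Rightarrow> real \<Rightarrow> real \<Rightarrow> real" where
  "time_deriv T w t y = vector_derivative (\<lambda>s. w s y) (at t within {0<..T})"

text \<open>A curve in the finite-dimensional space \<open>V\<^sub>h\<^sup>k\<close> is differentiable iff its point
  values in the interior of the cells are.\<close>

definition time_differentiable ::
  "nat \<Rightarrow> (nat \<Rightarrow> real) \<Rightarrow> real \<Rightarrow> (real \<Rightarrow> real \<Rightarrow> real) \<Rightarrow> bool" where
  "time_differentiable N X T w \<longleftrightarrow>
     (\<forall>t\<in>{0<..T}. \<forall>j\<in>{1..N}. \<forall>y\<in>interior (cell X j).
        (\<lambda>s. w s y) differentiable (at t within {0<..T}))"

text \<open>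
  Test functions are polynomials, so their traces are point values. In the last equation the
  convention \<open>\<P>\<^sup>-\<^sup>1 = \<P>\<^sup>0\<close> is implemented by the truncated subtraction \<open>0 - 1 = 0\<close> on \<^typ>\<open>nat\<close>.
\<close>

definition OF_EDG_solution ::
  "nat \<Rightarrow> (nat \<Rightarrow> real) \<Rightarrow> real \<Rightarrow> nat \<Rightarrow> nat \<Rightarrow> real \<Rightarrow> real \<Rightarrow> real \<Rightarrow> real \<Rightarrow>
    (real \<Rightarrow> real \<Rightarrow> real) \<Rightarrow> (real \<Rightarrow> real \<Rightarrow> real) \<Rightarrow> bool" where
  "OF_EDG_solution N X T p q \<alpha> \<tau> \<beta> c u v \<longleftrightarrow>
     (\<forall>t\<in>{0<..T}. u t \<in> Vh N X p \<and> v t \<in> Vh N X q) \<and>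
     time_differentiable N X T u \<and> time_differentiable N X T v \<and>
     (\<forall>t\<in>{0<..T}. \<forall>j\<in>{1..N}.
        integral (cell X j) (\<lambda>y. time_deriv T u t y - v t y) = 0 \<and>
        (\<forall>\<phi>. degree \<phi> \<le> p \<longrightarrow>
           integral (cell X j)
             (\<lambda>y. deriv (\<lambda>y. time_deriv T u t y - v t y) y * poly (pderiv \<phi>) y) =
             (flux_v N X \<alpha> \<tau> (u t) (v t) j - trace_minus N X (v t) j) * poly (pderiv \<phi>) (X j)
           - (flux_v N X \<alpha> \<tau> (u t) (v t) (j - 1) - trace_plus N X (v t) (j - 1))
               * poly (pderiv \<phi>) (X (j - 1))
           + c / (mesh_size N X)\<^sup>2 *
               (jump N X (u t) j * poly \<phi> (X j) - jump N X (u t) (j - 1) * poly \<phi> (X (j - 1)))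
           - (\<Sum>l=1..p. sigma N X p (u t) l j / cell_size X j *
               integral (cell X j)
                 (\<lambda>y. (deriv (u t) y - L2_proj N X (l - 1) (deriv (u t)) y)
                        * poly (pderiv \<phi>) y))) \<and>
        (\<forall>\<phi>. degree \<phi> \<le> q \<longrightarrow>
           integral (cell X j)
             (\<lambda>y. time_deriv T v t y * poly \<phi> y + deriv (u t) y * poly (pderiv \<phi>) y) =
             flux_ux N X \<alpha> \<beta> (u t) (v t) j * poly \<phi> (X j)
           - flux_ux N X \<alpha> \<beta> (u t) (v t) (j - 1) * poly \<phi> (X (j - 1))
           - (\<Sum>l=0..q. sigma_tilde N X q (v t) l j / cell_size X j *
               integral (cell X j)
                 (\<lambda>y. (v t y - L2_proj N X (l - 1) (v t) y) * poly \<phi> y))))"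

definition energy :: "real \<Rightarrow> real \<Rightarrow> (real \<Rightarrow> real) \<Rightarrow> (real \<Rightarrow> real) \<Rightarrow> real" where
  "energy a b u v = integral {a<..<b} (\<lambda>y. (deriv u y)\<^sup>2 + (v y)\<^sup>2)"

end

(* Test the second equation with u_h and the third with v_h. The volume terms
   (v_h)_x (u_h)_x cancel, leaving half the time derivative of the energy on the left. By
   periodicity the cell boundary terms regroup into one contribution per interface; the
   alternating part of the fluxes cancels against [[v_h (u_h)_x]], and what remains is
   -tau [[(u_h)_x]]^2 - beta [[v_h]]^2 - (c/h^2) [[u_h]]^2. Each damping term is nonpositive
   because int (w - P w) w = int (w - P w)^2 for the orthogonal projection P. *)
theory Submission
  imports Defs
begin

section \<open>Polynomials on an interval\<close>

lemma poly_integrable_on: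
  fixes P :: "real poly"
  shows "poly P integrable_on {A..B}"
  by (intro integrable_continuous_interval continuous_intros)

text \<open>Elements of \<open>Vh\<close> take arbitrary values at the interfaces. The two end
  points of a cell are negligible, so cell integrals can be computed with the polynomial
  representative.\<close>

lemma
  fixes f :: "real \<Rightarrow> real"
  assumes "\<And>y. y \<in> {A<..<B} \<Longrightarrow> f y = poly P y"
  shows integral_eq_poly: "integral {A..B} f = integral {A..B} (poly P)"
    and integrable_on_eq_poly: "f integrable_on {A..B}"
proof -
  have neg: "negligible {A, B}" by simp
  show "integral {A..B} f = integral {A..B} (poly P)"
    by (rule integral_spike[OF neg]) (use assms in auto)
  show "f integrable_on {A..B}"
    by (rule integrable_spike[OF poly_integrable_on[of P A B] neg]) (use assms in auto)
qed

lemma integral_poly_add: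
  fixes P Q :: "real poly"
  shows "integral {A..B} (poly (P + Q)) = integral {A..B} (poly P) + integral {A..B} (poly Q)"
proof -
  have "poly (P + Q) = (\<lambda>y. poly P y + poly Q y)" by (rule ext) simp
  then show ?thesis using integral_add[OF poly_integrable_on poly_integrable_on] by metis
qed

lemma integral_poly_diff:
  fixes P Q :: "real poly"
  shows "integral {A..B} (poly (P - Q)) = integral {A..B} (poly P) - integral {A..B} (poly Q)"
proof -
  have "poly (P - Q) = (\<lambda>y. poly P y - poly Q y)" by (rule ext) simp
  then show ?thesis using integral_diff[OF poly_integrable_on poly_integrable_on] by metis
qed

lemma integral_poly_smult:
  fixes P :: "real poly"
  shows "integral {A..B} (poly (smult r P)) = r * integral {A..B} (poly P)"
proof -
  have "poly (smult r P) = (\<lambda>y. r * poly P y)" by (rule ext) simp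
  then show ?thesis by simp
qed

lemma poly_eq_sum_coeff:
  fixes P :: "real poly"
  assumes "degree P \<le> n"
  shows "poly P y = (\<Sum>i\<le>n. coeff P i * y ^ i)"
  unfolding poly_altdef
  by (rule sum.mono_neutral_left) (use assms in \<open>auto simp: coeff_eq_0\<close>)

text \<open>With \<open>n\<close> fixed in advance, the integral is one and the same linear
  functional of the coefficients for all these polynomials. Time derivatives then pass through a
  finite sum instead of an integral sign.\<close>

lemma integral_poly_eq_sum:
  fixes P :: "real poly"
  assumes "degree P \<le> n"
  shows "integral {A..B} (poly P) = (\<Sum>i\<le>n. coeff P i * integral {A..B} (\<lambda>y. y ^ i))"
proof -
  have "poly P = (\<lambda>y. \<Sum>i\<le>n. coeff P i * y ^ i)"
    using assms by (intro ext) (rule poly_eq_sum_coeff)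
  moreover have "(\<lambda>y. coeff P i * y ^ i) integrable_on {A..B}" for i
    by (intro integrable_continuous_interval continuous_intros)
  ultimately show ?thesis
    by (simp add: integral_sum)
qed

section \<open>Positive definiteness of the L2 inner product on polynomials\<close>

lemma integral_poly_square_nonneg:
  fixes P :: "real poly"
  shows "integral {A..B} (poly (P * P)) \<ge> 0"
  by (rule integral_nonneg[OF poly_integrable_on]) simp

lemma poly_eq_0_interval:
  fixes P :: "real poly"
  assumes "A < B" "\<And>y. y \<in> {A..B} \<Longrightarrow> poly P y = 0"
  shows "P = 0"
proof (rule ccontr)
  assume "P \<noteq> 0"
  then have "finite {y. poly P y = 0}" by (rule poly_roots_finite)
  moreover have "{A..B} \<subseteq> {y. poly P y = 0}" using assms by auto
  ultimately have "finite {A..B}" by (rule rev_finite_subset)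
  then show False using assms(1) infinite_Icc by blast
qed

lemma integral_poly_square_pos:
  fixes P :: "real poly"
  assumes "A < B" "P \<noteq> 0"
  shows "integral {A..B} (poly (P * P)) > 0"
proof -
  have "integral {A..B} (poly (P * P)) \<noteq> 0"
  proof
    assume "integral {A..B} (poly (P * P)) = 0"
    then have "\<forall>y\<in>{A..B}. poly (P * P) y = 0"
      using assms(1) by (subst (asm) integral_eq_0_iff) (auto intro!: continuous_intros)
    then show False using poly_eq_0_interval[OF assms(1), of P] assms(2) by auto
  qed
  then show ?thesis using integral_poly_square_nonneg[of A B P] by linarith
qed

text \<open>
  One Gram--Schmidt step per degree. The condition \<open>\<forall>i\<ge>n. coeff P i = 0\<close> means degree below \<open>n\<close>
  and, unlike \<^term>\<open>degree\<close>, lets the induction start from the zero space.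
\<close>

lemma poly_projection_exists:
  fixes W :: "real poly"
  assumes "A < B"
  shows "\<exists>Z. (\<forall>i\<ge>n. coeff Z i = 0) \<and>
    (\<forall>\<phi>. (\<forall>i\<ge>n. coeff \<phi> i = 0) \<longrightarrow> integral {A..B} (poly ((Z - W) * \<phi>)) = 0)"
proof (induction n arbitrary: W)
  case 0
  have "integral {A..B} (poly ((0 - W) * \<phi>)) = 0" if "\<forall>i\<ge>0. coeff \<phi> i = 0" for \<phi>
  proof -
    have "\<phi> = 0" using that by (simp add: poly_eq_iff)
    then have "poly ((0 - W) * \<phi>) = (\<lambda>_. 0)" by (intro ext) simp
    then show ?thesis by simp
  qed
  then show ?case by (intro exI[of _ 0] conjI allI impI) (simp, blast)
next
  case (Suc n)
  obtain R where R: "\<forall>i\<ge>n. coeff R i = 0"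
    "\<And>\<phi>. \<forall>i\<ge>n. coeff \<phi> i = 0 \<Longrightarrow> integral {A..B} (poly ((R - monom 1 n) * \<phi>)) = 0"
    using Suc.IH[of "monom 1 n"] by blast
  obtain Y where Y: "\<forall>i\<ge>n. coeff Y i = 0"
    "\<And>\<phi>. \<forall>i\<ge>n. coeff \<phi> i = 0 \<Longrightarrow> integral {A..B} (poly ((Y - W) * \<phi>)) = 0"
    using Suc.IH[of W] by blast
  \<comment> \<open>Up to sign, \<open>Q\<close> is the monic orthogonal polynomial of degree
    \<open>n\<close>: it is orthogonal to all lower degrees and has leading coefficient -1.\<close>
  define Q where "Q = R - monom 1 n"
  have Qn: "coeff Q n = -1" and Qi: "\<forall>i\<ge>Suc n. coeff Q i = 0"
    using R(1) by (auto simp: Q_def)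
  then have "Q \<noteq> 0" by auto
  then have pos: "integral {A..B} (poly (Q * Q)) > 0"
    by (rule integral_poly_square_pos[OF assms])
  \<comment> \<open>The value of \<open>r\<close> that makes \<open>Z - W\<close> orthogonal to
    \<open>Q\<close>. Adding a multiple of \<open>Q\<close> keeps the orthogonality to lower
    degrees.\<close>
  define r where "r = - integral {A..B} (poly ((Y - W) * Q)) / integral {A..B} (poly (Q * Q))"
  define Z where "Z = Y + smult r Q"
  have Zi: "\<forall>i\<ge>Suc n. coeff Z i = 0" using Y(1) Qi by (auto simp: Z_def)
  have "integral {A..B} (poly ((Z - W) * \<phi>)) = 0" if "\<forall>i\<ge>Suc n. coeff \<phi> i = 0" for \<phi>
  proof -
    \<comment> \<open>Since \<open>coeff Q n = -1\<close>, this removes the term of degree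
      \<open>n\<close> from \<open>\<phi>\<close>, so both induction hypotheses apply to
      \<open>\<psi>\<close>.\<close>
    define \<psi> where "\<psi> = \<phi> + smult (coeff \<phi> n) Q"
    have \<psi>: "\<forall>i\<ge>n. coeff \<psi> i = 0"
    proof (intro allI impI)
      fix i assume "n \<le> i"
      then consider "i = n" | "i \<ge> Suc n" by linarith
      then show "coeff \<psi> i = 0" using that Qn Qi by cases (auto simp: \<psi>_def)
    qed
    have \<phi>: "\<phi> = \<psi> - smult (coeff \<phi> n) Q" by (simp add: \<psi>_def)
    have eq: "(Z - W) * \<phi> =
        ((Y - W) * \<psi> + smult r (Q * \<psi>))
        - smult (coeff \<phi> n) ((Y - W) * Q + smult r (Q * Q))"
      by (subst \<phi>) (simp add: Z_def algebra_simps smult_add_right smult_diff_right)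
    have "integral {A..B} (poly ((Y - W) * Q + smult r (Q * Q))) = 0"
      unfolding integral_poly_add integral_poly_smult using pos by (simp add: r_def)
    moreover have "integral {A..B} (poly ((Y - W) * \<psi> + smult r (Q * \<psi>))) = 0"
      unfolding integral_poly_add integral_poly_smult
      using Y(2)[OF \<psi>] R(2)[OF \<psi>] by (simp add: Q_def)
    ultimately show ?thesis
      unfolding eq integral_poly_diff integral_poly_smult by simp
  qed
  with Zi show ?case by blast
qed

text \<open>\<open>M y\<close> vanishes at every node except \<open>y\<close>, so its normalization
  \<open>L y\<close> is the Lagrange basis polynomial. Both sides of the expansion have degree at
  most \<open>k\<close> and agree at \<open>k + 1\<close> nodes.\<close>

lemma poly_lagrange_basis:
  fixes S :: "real set"
  assumes "finite S" "card S = Suc k"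
  obtains L where "\<And>P. degree P \<le> k \<Longrightarrow> P = (\<Sum>y\<in>S. smult (poly P y) (L y))"
    "\<And>y. y \<in> S \<Longrightarrow> degree (L y) \<le> k"
proof -
  define M where "M y = (\<Prod>z\<in>S-{y}. [:-z, 1:])" for y :: real
  define L where "L y = smult (inverse (poly (M y) y)) (M y)" for y
  have deg: "degree (L y) \<le> k" if "y \<in> S" for y
  proof -
    have "degree (M y) \<le> sum (degree \<circ> (\<lambda>z. [:-z, 1:])) (S - {y})"
      unfolding M_def by (rule degree_prod_sum_le) (use assms in auto)
    also have "\<dots> = k" using that assms by simp
    finally show ?thesis unfolding L_def using degree_smult_le order_trans by blast
  qed
  have val: "poly (L y) z = (if z = y then 1 else 0)" if "y \<in> S" "z \<in> S" for y z
    using that assms by (auto simp: L_def M_def poly_prod)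
  have "P = (\<Sum>y\<in>S. smult (poly P y) (L y))" if "degree P \<le> k" for P
  proof (rule poly_eqI_degree[where A = S])
    show "poly P z = poly (\<Sum>y\<in>S. smult (poly P y) (L y)) z" if "z \<in> S" for z
    proof -
      have "poly (\<Sum>y\<in>S. smult (poly P y) (L y)) z = (\<Sum>y\<in>S. if z = y then poly P y else 0)"
        unfolding poly_sum by (rule sum.cong) (use that val in auto)
      then show ?thesis using that assms by simp
    qed
    show "card S > degree P" using that assms by simp
    have "degree (\<Sum>y\<in>S. smult (poly P y) (L y)) \<le> k"
      by (rule degree_sum_le) (use assms deg degree_smult_le order_trans in blast)+
    then show "card S > degree (\<Sum>y\<in>S. smult (poly P y) (L y))" using assms by simp
  qed
  with deg show ?thesis using that by blast
qed

section \<open>Differentiable curves of polynomials\<close>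

text \<open>Differentiation is taken coefficient by coefficient, which avoids a norm on polynomials.
  \<open>D\<close> is the time set, so the derivative is one-sided at an end point belonging to
  \<open>D\<close>.\<close>

definition poly_curve_deriv ::
  "real set \<Rightarrow> (real \<Rightarrow> real poly) \<Rightarrow> real \<Rightarrow> real poly \<Rightarrow> bool" where
  "poly_curve_deriv D P t P' \<longleftrightarrow>
     (\<forall>i. ((\<lambda>s. coeff (P s) i) has_real_derivative coeff P' i) (at t within D))"

lemma poly_curve_deriv_add:
  assumes "poly_curve_deriv D P t P'" "poly_curve_deriv D Q t Q'"
  shows "poly_curve_deriv D (\<lambda>s. P s + Q s) t (P' + Q')"
  using assms unfolding poly_curve_deriv_def by (auto intro!: derivative_eq_intros)

lemma poly_curve_deriv_pderiv:
  assumes "poly_curve_deriv D P t P'"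
  shows "poly_curve_deriv D (\<lambda>s. pderiv (P s)) t (pderiv P')"
  using assms unfolding poly_curve_deriv_def coeff_pderiv
  by (auto intro!: DERIV_cmult simp del: of_nat_Suc)

text \<open>Each coefficient of a product is a finite convolution, to which the scalar product rule
  applies termwise.\<close>

lemma poly_curve_deriv_mult:
  assumes "poly_curve_deriv D P t P'" "poly_curve_deriv D Q t Q'"
  shows "poly_curve_deriv D (\<lambda>s. P s * Q s) t (P' * Q t + P t * Q')"
  unfolding poly_curve_deriv_def
proof
  fix i
  have "((\<lambda>s. \<Sum>k\<le>i. coeff (P s) k * coeff (Q s) (i - k)) has_real_derivative
     (\<Sum>k\<le>i. coeff (P t) k * coeff Q' (i - k) + coeff P' k * coeff (Q t) (i - k))) (at t within D)"
    using assms unfolding poly_curve_deriv_def by (intro DERIV_sum DERIV_mult') auto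
  then show "((\<lambda>s. coeff (P s * Q s) i) has_real_derivative
      coeff (P' * Q t + P t * Q') i) (at t within D)"
    by (simp add: coeff_mult sum.distrib add.commute)
qed

text \<open>A degree bound uniform in time turns the integral into a linear combination of
  coefficients with constant weights. The bound holds only on \<open>D\<close>, hence the passage by
  agreement within \<open>D\<close>.\<close>

lemma poly_curve_deriv_integral:
  assumes "poly_curve_deriv D P t P'" and "\<And>s. s \<in> D \<Longrightarrow> degree (P s) \<le> n"
    and "degree P' \<le> n" and "t \<in> D"
  shows "((\<lambda>s. integral {A..B} (poly (P s))) has_real_derivative integral {A..B} (poly P'))
    (at t within D)"
proof -
  have "((\<lambda>s. \<Sum>i\<le>n. coeff (P s) i * integral {A..B} (\<lambda>y. y ^ i)) has_real_derivative
     (\<Sum>i\<le>n. coeff P' i * integral {A..B} (\<lambda>y. y ^ i))) (at t within D)"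
    using assms(1) unfolding poly_curve_deriv_def by (intro DERIV_sum DERIV_cmult_right) auto
  then have "((\<lambda>s. \<Sum>i\<le>n. coeff (P s) i * integral {A..B} (\<lambda>y. y ^ i)) has_real_derivative
      integral {A..B} (poly P')) (at t within D)"
    by (simp add: integral_poly_eq_sum[OF assms(3)])
  then show ?thesis
    by (rule has_field_derivative_transform_within[OF _ zero_less_one \<open>t \<in> D\<close>])
      (simp add: integral_poly_eq_sum[OF assms(2)])
qed

lemma poly_curve_deriv_poly:
  assumes "poly_curve_deriv D P t P'" and "\<And>s. s \<in> D \<Longrightarrow> degree (P s) \<le> n"
    and "degree P' \<le> n" and "t \<in> D"
  shows "((\<lambda>s. poly (P s) y) has_real_derivative poly P' y) (at t within D)"
proof -
  have "((\<lambda>s. \<Sum>i\<le>n. coeff (P s) i * y ^ i) has_real_derivative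
     (\<Sum>i\<le>n. coeff P' i * y ^ i)) (at t within D)"
    using assms(1) unfolding poly_curve_deriv_def by (intro DERIV_sum DERIV_cmult_right) auto
  then have "((\<lambda>s. \<Sum>i\<le>n. coeff (P s) i * y ^ i) has_real_derivative
      poly P' y) (at t within D)"
    by (simp add: poly_eq_sum_coeff[OF assms(3)])
  then show ?thesis
    by (rule has_field_derivative_transform_within[OF _ zero_less_one \<open>t \<in> D\<close>])
      (simp add: poly_eq_sum_coeff[OF assms(2)])
qed

text \<open>Lagrange interpolation in interior points reduces the coefficients to point values.\<close>

lemma poly_curve_of_pointwise:
  fixes w :: "real \<Rightarrow> real \<Rightarrow> real"
  assumes "A < B"
    and rep: "\<And>s. s \<in> D \<Longrightarrow> \<exists>P. degree P \<le> k \<and> (\<forall>y\<in>{A<..<B}. w s y = poly P y)"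
    and diff: "\<And>t y. t \<in> D \<Longrightarrow> y \<in> {A<..<B} \<Longrightarrow> (\<lambda>s. w s y) differentiable (at t within D)"
  shows "\<exists>P P'. \<forall>t\<in>D. degree (P t) \<le> k \<and> degree (P' t) \<le> k \<and>
    (\<forall>y\<in>{A<..<B}. w t y = poly (P t) y) \<and> poly_curve_deriv D P t (P' t)"
proof -
  \<comment> \<open>The nodes are chosen once for all times, so the basis \<open>L\<close> is
    constant in time and only the nodal values vary.\<close>
  obtain S where S: "finite S" "card S = Suc k" "S \<subseteq> {A<..<B}"
    using infinite_arbitrarily_large[of "{A<..<B}" "Suc k"] infinite_Ioo[OF assms(1)] by blast
  obtain L where L: "\<And>P. degree P \<le> k \<Longrightarrow> P = (\<Sum>y\<in>S. smult (poly P y) (L y))"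
    and degL: "\<And>y. y \<in> S \<Longrightarrow> degree (L y) \<le> k"
    by (rule poly_lagrange_basis[OF S(1,2)]) blast
  have "\<forall>t\<in>D. \<forall>y\<in>S. \<exists>d. ((\<lambda>s. w s y) has_real_derivative d) (at t within D)"
    using diff S(3) real_differentiable_def by blast
  then obtain d where
    d: "\<And>t y. t \<in> D \<Longrightarrow> y \<in> S \<Longrightarrow> ((\<lambda>s. w s y) has_real_derivative d t y) (at t within D)"
    by metis
  have deg: "degree (\<Sum>y\<in>S. smult (f y) (L y)) \<le> k" for f
    by (rule degree_sum_le[OF S(1)]) (use degL degree_smult_le order_trans in blast)
  define P where "P s = (\<Sum>y\<in>S. smult (w s y) (L y))" for s
  \<comment> \<open>Interpolating the time derivatives of the nodal values gives the derivative of
    the interpolant.\<close>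
  define P' where "P' s = (\<Sum>y\<in>S. smult (d s y) (L y))" for s
  have "w t y = poly (P t) y" if t: "t \<in> D" and y: "y \<in> {A<..<B}" for t y
  proof -
    obtain Q where Q: "degree Q \<le> k" "\<And>y. y \<in> {A<..<B} \<Longrightarrow> w t y = poly Q y"
      using rep[OF t] by blast
    have "P t = (\<Sum>y\<in>S. smult (poly Q y) (L y))"
      unfolding P_def by (rule sum.cong) (use Q(2) S(3) in auto)
    also have "\<dots> = Q" using L[OF Q(1)] by simp
    finally show ?thesis using Q(2)[OF y] by simp
  qed
  moreover have "poly_curve_deriv D P t (P' t)" if "t \<in> D" for t
    unfolding poly_curve_deriv_def P_def P'_def coeff_sum coeff_smult
    using that by (intro allI DERIV_sum DERIV_cmult_right d)
  moreover have "degree (P t) \<le> k" "degree (P' t) \<le> k" for t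
    using deg unfolding P_def P'_def by blast+
  ultimately show ?thesis by blast
qed

section \<open>Piecewise polynomials\<close>

text \<open>A membership in \<open>Vh\<close> with the polynomials named. Open cells leave the
  interface values free; leaving out the degree bound lets the same notion cover spatial and time
  derivatives.\<close>

definition piecewise_poly ::
  "nat \<Rightarrow> (nat \<Rightarrow> real) \<Rightarrow> (real \<Rightarrow> real) \<Rightarrow> (nat \<Rightarrow> real poly) \<Rightarrow> bool" where
  "piecewise_poly N X w W \<longleftrightarrow> (\<forall>j\<in>{1..N}. \<forall>y\<in>{X (j - 1)<..<X j}. w y = poly (W j) y)"

lemma piecewise_polyD:
  "piecewise_poly N X w W \<Longrightarrow> j \<in> {1..N} \<Longrightarrow> y \<in> {X (j - 1)<..<X j} \<Longrightarrow> w y = poly (W j) y"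
  by (simp add: piecewise_poly_def)

lemma deriv_eq_poly_pderiv:
  fixes f :: "real \<Rightarrow> real"
  assumes "\<And>y. y \<in> {A<..<B} \<Longrightarrow> f y = poly P y" "y \<in> {A<..<B}"
  shows "deriv f y = poly (pderiv P) y"
proof (rule DERIV_imp_deriv)
  show "(f has_real_derivative poly (pderiv P) y) (at y)"
    by (rule has_field_derivative_transform_within_open[OF poly_DERIV, of "{A<..<B}"])
      (use assms in auto)
qed

lemma piecewise_poly_deriv:
  assumes "piecewise_poly N X w W"
  shows "piecewise_poly N X (deriv w) (\<lambda>j. pderiv (W j))"
  using assms deriv_eq_poly_pderiv unfolding piecewise_poly_def by blast

section \<open>One-sided traces and integrals over the whole mesh\<close>

lemma trace_minus_eq:
  assumes "mesh a b N X" "piecewise_poly N X w W" "j \<in> {1..N}"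
  shows "trace_minus N X w j = poly (W j) (X j)"
proof -
  have lt: "X (j - 1) < X j" using assms by (auto simp: mesh_def)
  have "\<forall>\<^sub>F y in at_left (X j). y \<in> {X (j - 1)<..<X j}"
    by (rule eventually_at_leftI[OF _ lt])
  then have "\<forall>\<^sub>F y in at_left (X j). poly (W j) y = w y"
    by (rule eventually_mono) (use piecewise_polyD[OF assms(2,3)] in auto)
  moreover have "(poly (W j) \<longlongrightarrow> poly (W j) (X j)) (at_left (X j))"
    by (intro tendsto_intros)
  ultimately have "(w \<longlongrightarrow> poly (W j) (X j)) (at_left (X j))"
    by (rule Lim_transform_eventually[rotated])
  then show ?thesis
    using assms(3) unfolding trace_minus_def by (auto intro!: tendsto_Lim)
qed

lemma trace_plus_eq:
  assumes "mesh a b N X" "piecewise_poly N X w W" "j \<in> {1..N}"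
  shows "trace_plus N X w (j - 1) = poly (W j) (X (j - 1))"
proof -
  have lt: "X (j - 1) < X j" using assms by (auto simp: mesh_def)
  have "\<forall>\<^sub>F y in at_right (X (j - 1)). y \<in> {X (j - 1)<..<X j}"
    by (rule eventually_at_rightI[OF _ lt])
  then have "\<forall>\<^sub>F y in at_right (X (j - 1)). poly (W j) y = w y"
    by (rule eventually_mono) (use piecewise_polyD[OF assms(2,3)] in auto)
  moreover have "(poly (W j) \<longlongrightarrow> poly (W j) (X (j - 1))) (at_right (X (j - 1)))"
    by (intro tendsto_intros)
  ultimately have "(w \<longlongrightarrow> poly (W j) (X (j - 1))) (at_right (X (j - 1)))"
    by (rule Lim_transform_eventually[rotated])
  \<comment> \<open>The left end of a cell is never interface \<open>N\<close>, so the periodic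
    wrap-around in \<open>trace_plus\<close> does not apply.\<close>
  moreover have "j - 1 \<noteq> N" using assms(3) by auto
  ultimately show ?thesis
    unfolding trace_plus_def by (auto intro!: tendsto_Lim)
qed

lemma trace_periodic:
  assumes "N \<ge> 1"
  shows "trace_minus N X w 0 = trace_minus N X w N" "trace_plus N X w 0 = trace_plus N X w N"
  using assms by (auto simp: trace_minus_def trace_plus_def)

text \<open>Order and integrability are carried through the induction because joining two adjacent
  integrals requires them.\<close>

lemma integral_cells:
  fixes f :: "real \<Rightarrow> real" and X :: "nat \<Rightarrow> real"
  assumes "\<And>j. j \<in> {1..n} \<Longrightarrow> X (j - 1) < X j"
    and "\<And>j. j \<in> {1..n} \<Longrightarrow> f integrable_on {X (j - 1)..X j}"
  shows "X 0 \<le> X n \<and> f integrable_on {X 0..X n} \<and>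
    integral {X 0..X n} f = (\<Sum>j=1..n. integral {X (j - 1)..X j} f)"
  using assms
proof (induction n)
  case 0
  then show ?case using integrable_on_refl[of f "X 0"] by simp
next
  case (Suc n)
  have "X 0 \<le> X n \<and> f integrable_on {X 0..X n} \<and>
    integral {X 0..X n} f = (\<Sum>j=1..n. integral {X (j - 1)..X j} f)"
    by (rule Suc.IH) (use Suc.prems in auto)
  then have IH: "X 0 \<le> X n" "f integrable_on {X 0..X n}"
    "integral {X 0..X n} f = (\<Sum>j=1..n. integral {X (j - 1)..X j} f)"
    by auto
  have le: "X n \<le> X (Suc n)" and i: "f integrable_on {X n..X (Suc n)}"
    using Suc.prems(1)[of "Suc n"] Suc.prems(2)[of "Suc n"] by auto
  have i2: "f integrable_on {X 0..X (Suc n)}"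
    by (rule Henstock_Kurzweil_Integration.integrable_combine[OF IH(1) le IH(2) i])
  show ?case
    using IH le i2 Henstock_Kurzweil_Integration.integral_combine[OF IH(1) le i2] by (auto simp: sum.cl_ivl_Suc)
qed

text \<open>As \<open>L2_proj\<close> is a choice by \<open>SOME\<close>, a projection must first be
  constructed. Testing its orthogonality with the projection itself then identifies the integral
  with that of the squared residual.\<close>

lemma L2_proj_residual:
  assumes m: "mesh a b N X" and w: "piecewise_poly N X w W" and j: "j \<in> {1..N}"
  shows "integral (cell X j) (\<lambda>y. (w y - L2_proj N X l w y) * poly (W j) y) \<ge> 0"
proof -
  have lt: "X (i - 1) < X i" if "i \<in> {1..N}" for i using m that by (auto simp: mesh_def)
  define Pr where "Pr z \<longleftrightarrow> z \<in> Vh N X l \<and>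
     (\<forall>j\<in>{1..N}. \<forall>\<phi>. degree \<phi> \<le> l \<longrightarrow>
        integral (cell X j) (\<lambda>y. (z y - w y) * poly \<phi> y) = 0)" for z
  have coeff_degree: "(\<forall>i\<ge>Suc l. coeff P i = 0) \<longleftrightarrow> degree P \<le> l" for P :: "real poly"
    by (metis Suc_le_eq coeff_eq_0 degree_le le_less_trans)
  have "\<forall>i\<in>{1..N}. \<exists>Z. degree Z \<le> l \<and>
      (\<forall>\<phi>. degree \<phi> \<le> l \<longrightarrow> integral {X (i - 1)..X i} (poly ((Z - W i) * \<phi>)) = 0)"
    using poly_projection_exists[OF lt, of _ "Suc l"] unfolding coeff_degree by blast
  then obtain Z where Z: "\<And>i. i \<in> {1..N} \<Longrightarrow> degree (Z i) \<le> l"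
    "\<And>i \<phi>. i \<in> {1..N} \<Longrightarrow> degree \<phi> \<le> l \<Longrightarrow>
      integral {X (i - 1)..X i} (poly ((Z i - W i) * \<phi>)) = 0"
    by metis
  \<comment> \<open>Glues the cellwise projections: in the interior of cell \<open>i\<close>, the
    first interface to the right of \<open>y\<close> has index \<open>i\<close>.\<close>
  define z where "z y = poly (Z (LEAST i. y < X i)) y" for y
  have mono: "X i \<le> X k" if "i \<le> k" "k \<le> N" for i k
    using that
  proof (induction k)
    case (Suc k)
    then show ?case using lt[of "Suc k"] by (cases "i = Suc k") auto
  qed simp
  have zrep: "piecewise_poly N X z Z"
    unfolding piecewise_poly_def
  proof (intro ballI)
    fix i y assume i: "i \<in> {1..N}" and y: "y \<in> {X (i - 1)<..<X i}"
    have "(LEAST i. y < X i) = i"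
    proof (rule Least_equality)
      show "y < X i" using y by simp
      show "i \<le> k" if "y < X k" for k
      proof (rule ccontr)
        assume "\<not> i \<le> k"
        then have "X k \<le> X (i - 1)" using i by (intro mono) auto
        then show False using that y by simp
      qed
    qed
    then show "z y = poly (Z i) y" by (simp add: z_def)
  qed
  have "Pr z"
    unfolding Pr_def
  proof (intro conjI ballI allI impI)
    show "z \<in> Vh N X l"
      using zrep Z(1) unfolding Vh_def piecewise_poly_def cell_def interior_atLeastAtMost_real
      by blast
    fix i \<phi> assume i: "i \<in> {1..N}" and \<phi>: "degree (\<phi> :: real poly) \<le> l"
    show "integral (cell X i) (\<lambda>y. (z y - w y) * poly \<phi> y) = 0"
      unfolding cell_def
      by (subst integral_eq_poly[where P = "(Z i - W i) * \<phi>"])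
        (use piecewise_polyD[OF zrep i] piecewise_polyD[OF w i] Z(2)[OF i \<phi>] in auto)
  qed
  then have "Pr (L2_proj N X l w)"
    unfolding L2_proj_def Pr_def[symmetric] by (rule someI[of Pr])
  then obtain Y where Y: "degree Y \<le> l" "\<And>y. y \<in> {X (j - 1)<..<X j} \<Longrightarrow> L2_proj N X l w y = poly Y y"
    and orth: "integral (cell X j) (\<lambda>y. (L2_proj N X l w y - w y) * poly Y y) = 0"
    unfolding Pr_def Vh_def cell_def interior_atLeastAtMost_real using j by blast
  have 1: "integral {X (j - 1)..X j} (poly ((Y - W j) * Y)) = 0"
    using orth unfolding cell_def
    by (subst (asm) integral_eq_poly[where P = "(Y - W j) * Y"])
      (use piecewise_polyD[OF w j] Y in auto)
  have "integral (cell X j) (\<lambda>y. (w y - L2_proj N X l w y) * poly (W j) y)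
      = integral {X (j - 1)..X j} (poly ((W j - Y) * W j))"
    unfolding cell_def
    by (rule integral_eq_poly) (use piecewise_polyD[OF w j] Y in auto)
  \<comment> \<open>The last product integrates to zero by \<open>1\<close>, leaving a
    square.\<close>
  also have "(W j - Y) * W j = (W j - Y) * (W j - Y) - (Y - W j) * Y"
    by (simp add: algebra_simps)
  also have "integral {X (j - 1)..X j} (poly \<dots>) \<ge> 0"
    using 1 integral_poly_square_nonneg unfolding integral_poly_diff by simp
  finally show ?thesis .
qed

text \<open>The lower bound on \<open>p\<close> makes the denominator \<open>2 * real p - 1\<close>
  positive. For \<open>sigma_tilde\<close> the parameter \<open>p\<close> stands for the degree
  q.\<close>

lemma sigma_nonneg:
  assumes "mesh a b N X" "j \<in> {1..N}" "p \<ge> 1"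
  shows "sigma N X p w l j \<ge> 0" "sigma_tilde N X p w l j \<ge> 0"
proof -
  have "cell_size X j \<ge> 0" using assms(1,2) by (simp add: mesh_def cell_size_def less_imp_le)
  then show "sigma N X p w l j \<ge> 0" "sigma_tilde N X p w l j \<ge> 0"
    using assms(3) unfolding sigma_def sigma_tilde_def
    by (intro mult_nonneg_nonneg divide_nonneg_nonneg zero_le_power real_sqrt_ge_zero; simp)+
qed

text \<open>The weights of the two fluxes are crossed: \<open>\<alpha>\<close> goes with the right
  trace of v and with the left trace of the derivative of u. The mixed products therefore cancel,
  and the rest is absorbed by the jump of the product.\<close>

lemma alternating_flux_identity:
  fixes vp vm up um \<alpha> \<tau> \<beta> :: real
  defines "fv \<equiv> \<alpha> * vp + (1 - \<alpha>) * vm + \<tau> * (up - um)"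
    and "fu \<equiv> (1 - \<alpha>) * up + \<alpha> * um + \<beta> * (vp - vm)"
  shows "((fv - vm) * um + fu * vm) - ((fv - vp) * up + fu * vp)
    = - \<tau> * (up - um)\<^sup>2 - \<beta> * (vp - vm)\<^sup>2"
  unfolding assms by (simp add: algebra_simps power2_eq_square)

text \<open>Used to move the left-end contribution of each cell to a sum over interfaces, where it
  meets the right-end contribution of the neighbouring cell.\<close>

lemma sum_periodic_shift:
  fixes F :: "nat \<Rightarrow> real"
  assumes "F 0 = F N"
  shows "(\<Sum>j=1..N. F (j - 1)) = (\<Sum>j=1..N. F j)"
proof -
  have "(\<Sum>j=1..N. F j - F (j - 1)) = F N - F 0"
    using sum_telescope''[of 0 N F] by (simp add: atLeastSucAtMost_greaterThanAtMost)
  then show ?thesis using assms by (simp add: sum_subtractf)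
qed

section \<open>The energy balance\<close>

text \<open>The sum is half the time derivative of the energy, written with the polynomials of the
  cells. It is bounded cell by cell through boundary terms and then regrouped by interface.\<close>

lemma OF_EDG_energy_rate:
  fixes U V U' V' :: "nat \<Rightarrow> real poly"
  assumes m: "mesh a b N X" and p: "p \<ge> 1" and q: "q \<ge> 1"
    and c: "c \<ge> 0" and \<tau>: "\<tau> \<ge> 0" and \<beta>: "\<beta> \<ge> 0"
    and sol: "OF_EDG_solution N X T p q \<alpha> \<tau> \<beta> c u v" and t: "t \<in> {0<..T}"
    and U: "piecewise_poly N X (u t) U" "\<And>j. j \<in> {1..N} \<Longrightarrow> degree (U j) \<le> p"
    and V: "piecewise_poly N X (v t) V" "\<And>j. j \<in> {1..N} \<Longrightarrow> degree (V j) \<le> q"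
    and U': "piecewise_poly N X (time_deriv T u t) U'"
    and V': "piecewise_poly N X (time_deriv T v t) V'"
  shows "(\<Sum>j=1..N. integral {X (j - 1)..X j}
    (poly (pderiv (U' j) * pderiv (U j) + V' j * V j))) \<le> 0"
proof -
  have N: "N \<ge> 1" using m by (simp add: mesh_def)
  define C where "C = c / (mesh_size N X)\<^sup>2"
  have C: "C \<ge> 0" using c by (simp add: C_def)
  define fv fu ju where "fv = flux_v N X \<alpha> \<tau> (u t) (v t)"
    and "fu = flux_ux N X \<alpha> \<beta> (u t) (v t)" and "ju = jump N X (u t)"
  \<comment> \<open>\<open>F i\<close> is what the cell ending at interface \<open>i\<close>
    receives there, and \<open>G i\<close> is what the cell starting there gives off.\<close>
  define F where "F i = (fv i - trace_minus N X (v t) i) * trace_minus N X (deriv (u t)) i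
    + C * ju i * trace_minus N X (u t) i + fu i * trace_minus N X (v t) i" for i
  define G where "G i = (fv i - trace_plus N X (v t) i) * trace_plus N X (deriv (u t)) i
    + C * ju i * trace_plus N X (u t) i + fu i * trace_plus N X (v t) i" for i
  note U_deriv = piecewise_poly_deriv[OF U(1)]
  have diff_rep: "piecewise_poly N X (\<lambda>y. time_deriv T u t y - v t y) (\<lambda>j. U' j - V j)"
    using U' V(1) by (simp add: piecewise_poly_def)
  have cell_le: "integral {X (j - 1)..X j} (poly (pderiv (U' j) * pderiv (U j) + V' j * V j))
      \<le> F j - G (j - 1)" if j: "j \<in> {1..N}" for j
  proof -
    note eqs = sol[unfolded OF_EDG_solution_def, THEN conjunct2, THEN conjunct2, THEN conjunct2,
        rule_format, OF t j]
    note tr = trace_minus_eq[OF m U(1) j, symmetric] trace_plus_eq[OF m U(1) j, symmetric]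
      trace_minus_eq[OF m U_deriv j, symmetric] trace_plus_eq[OF m U_deriv j, symmetric]
      trace_minus_eq[OF m V(1) j, symmetric] trace_plus_eq[OF m V(1) j, symmetric]
    have size: "cell_size X j \<ge> 0"
      using m j by (simp add: mesh_def cell_size_def less_imp_le)
    define Du where "Du = (\<Sum>l=1..p. sigma N X p (u t) l j / cell_size X j *
      integral (cell X j) (\<lambda>y. (deriv (u t) y - L2_proj N X (l - 1) (deriv (u t)) y)
        * poly (pderiv (U j)) y))"
    define Dv where "Dv = (\<Sum>l=0..q. sigma_tilde N X q (v t) l j / cell_size X j *
      integral (cell X j) (\<lambda>y. (v t y - L2_proj N X (l - 1) (v t) y) * poly (V j) y))"
    define A where "A = (fv j - trace_minus N X (v t) j) * poly (pderiv (U j)) (X j)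
        - (fv (j - 1) - trace_plus N X (v t) (j - 1)) * poly (pderiv (U j)) (X (j - 1))
        + C * (ju j * poly (U j) (X j) - ju (j - 1) * poly (U j) (X (j - 1)))"
    define B where "B = fu j * poly (V j) (X j) - fu (j - 1) * poly (V j) (X (j - 1))"
    have "Du \<ge> 0"
      unfolding Du_def
      by (intro sum_nonneg mult_nonneg_nonneg divide_nonneg_nonneg
          sigma_nonneg(1)[OF m j p] size L2_proj_residual[OF m U_deriv j])
    moreover have "Dv \<ge> 0"
      unfolding Dv_def
      by (intro sum_nonneg mult_nonneg_nonneg divide_nonneg_nonneg
          sigma_nonneg(2)[OF m j q] size L2_proj_residual[OF m V(1) j])
    moreover have "integral {X (j - 1)..X j} (poly ((pderiv (U' j) - pderiv (V j)) * pderiv (U j)))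
        = A - Du"
    proof -
      have "integral {X (j - 1)..X j} (poly ((pderiv (U' j) - pderiv (V j)) * pderiv (U j)))
        = integral (cell X j)
            (\<lambda>y. deriv (\<lambda>y. time_deriv T u t y - v t y) y * poly (pderiv (U j)) y)"
        unfolding cell_def
        by (rule integral_eq_poly[symmetric])
          (use piecewise_polyD[OF piecewise_poly_deriv[OF diff_rep] j] in \<open>simp add: pderiv_diff\<close>)
      also have "\<dots> = A - Du"
        unfolding A_def fv_def ju_def C_def Du_def
        using eqs[THEN conjunct2, THEN conjunct1, rule_format, OF U(2)[OF j]] .
      finally show ?thesis .
    qed
    moreover have "integral {X (j - 1)..X j} (poly (V' j * V j + pderiv (U j) * pderiv (V j)))
        = B - Dv"
    proof -
      have "integral {X (j - 1)..X j} (poly (V' j * V j + pderiv (U j) * pderiv (V j)))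
        = integral (cell X j)
            (\<lambda>y. time_deriv T v t y * poly (V j) y + deriv (u t) y * poly (pderiv (V j)) y)"
        unfolding cell_def
        by (rule integral_eq_poly[symmetric])
          (use piecewise_polyD[OF V' j] piecewise_polyD[OF U_deriv j] in simp)
      also have "\<dots> = B - Dv"
        unfolding B_def fu_def Dv_def
        using eqs[THEN conjunct2, THEN conjunct2, rule_format, OF V(2)[OF j]] .
      finally show ?thesis .
    qed
    \<comment> \<open>The products of \<open>pderiv (U j)\<close> and \<open>pderiv (V j)\<close>
      enter the two tested equations with opposite signs.\<close>
    moreover have "integral {X (j - 1)..X j} (poly (pderiv (U' j) * pderiv (U j) + V' j * V j)) =
        integral {X (j - 1)..X j} (poly ((pderiv (U' j) - pderiv (V j)) * pderiv (U j)))
        + integral {X (j - 1)..X j} (poly (V' j * V j + pderiv (U j) * pderiv (V j)))"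
      unfolding integral_poly_add[symmetric] by (simp add: algebra_simps)
    moreover have "F j - G (j - 1) = A + B"
      unfolding A_def B_def F_def G_def tr by (simp add: algebra_simps)
    ultimately show ?thesis by linarith
  qed
  \<comment> \<open>The penalty contributes \<open>C * ju i\<close> times left trace minus right
    trace, that is \<open>- C * (ju i)\<^sup>2\<close>.\<close>
  have FG: "F i - G i = - \<tau> * (jump N X (deriv (u t)) i)\<^sup>2 - \<beta> * (jump N X (v t) i)\<^sup>2
      - C * (ju i)\<^sup>2" for i
    using alternating_flux_identity[of \<alpha> "trace_plus N X (v t) i" "trace_minus N X (v t) i" \<tau>
        "trace_plus N X (deriv (u t)) i" "trace_minus N X (deriv (u t)) i" \<beta>]
    unfolding F_def G_def fv_def fu_def ju_def flux_v_def flux_ux_def jump_def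
    by (simp add: algebra_simps power2_eq_square)
  have G_periodic: "G 0 = G N"
    using trace_periodic[OF N]
    by (simp add: G_def fv_def fu_def ju_def flux_v_def flux_ux_def jump_def)
  have "(\<Sum>j=1..N. integral {X (j - 1)..X j}
      (poly (pderiv (U' j) * pderiv (U j) + V' j * V j))) \<le> (\<Sum>j=1..N. F j - G (j - 1))"
    by (intro sum_mono cell_le)
  also have "(\<Sum>j=1..N. F j - G (j - 1)) = (\<Sum>j=1..N. F j - G j)"
    unfolding sum_subtractf using sum_periodic_shift[OF G_periodic] by simp
  also have "\<dots> \<le> 0"
  proof (rule sum_nonpos)
    fix i
    have "\<tau> * (jump N X (deriv (u t)) i)\<^sup>2 \<ge> 0" "\<beta> * (jump N X (v t) i)\<^sup>2 \<ge> 0" "C * (ju i)\<^sup>2 \<ge> 0"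
      using C \<tau> \<beta> by simp_all
    then show "F i - G i \<le> 0" unfolding FG by simp
  qed
  finally show ?thesis .
qed

section \<open>The energy as a differentiable function of time\<close>

lemma energy_eq_sum_cells:
  assumes m: "mesh a b N X" and U: "piecewise_poly N X w U" and V: "piecewise_poly N X z V"
  shows "energy a b w z = (\<Sum>j=1..N. integral (cell X j) (\<lambda>y. (deriv w y)\<^sup>2 + (z y)\<^sup>2))"
    and "energy a b w z = (\<Sum>j=1..N. integral {X (j - 1)..X j}
      (poly (pderiv (U j) * pderiv (U j) + V j * V j)))"
proof -
  let ?f = "\<lambda>y. (deriv w y)\<^sup>2 + (z y)\<^sup>2"
  have f: "?f y = poly (pderiv (U j) * pderiv (U j) + V j * V j) y"
    if "j \<in> {1..N}" "y \<in> {X (j - 1)<..<X j}" for j y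
    using piecewise_polyD[OF piecewise_poly_deriv[OF U] that] piecewise_polyD[OF V that]
    by (simp add: power2_eq_square)
  have "integral {X 0..X N} ?f = (\<Sum>j=1..N. integral {X (j - 1)..X j} ?f)"
    using integral_cells[of N X ?f] integrable_on_eq_poly[OF f] m by (simp add: mesh_def)
  then show 1: "energy a b w z = (\<Sum>j=1..N. integral (cell X j) ?f)"
    using m by (simp add: energy_def mesh_def cell_def integral_open_interval_real)
  show "energy a b w z = (\<Sum>j=1..N. integral {X (j - 1)..X j}
      (poly (pderiv (U j) * pderiv (U j) + V j * V j)))"
    unfolding 1 cell_def by (intro sum.cong refl integral_eq_poly f)
qed

text \<open>The pointwise \<open>time_deriv\<close> is evaluated through coefficients, which shows
  that it is again piecewise polynomial in space with the same degree bound.\<close>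

lemma Vh_curve_representation:
  assumes m: "mesh a b N X" and w: "\<forall>t\<in>{0<..T}. w t \<in> Vh N X k"
    and d: "time_differentiable N X T w"
  obtains P P' where
    "\<And>t. t \<in> {0<..T} \<Longrightarrow> piecewise_poly N X (w t) (P t)"
    "\<And>t. t \<in> {0<..T} \<Longrightarrow> piecewise_poly N X (time_deriv T w t) (P' t)"
    "\<And>t j. t \<in> {0<..T} \<Longrightarrow> j \<in> {1..N} \<Longrightarrow> degree (P t j) \<le> k \<and> degree (P' t j) \<le> k"
    "\<And>t j. t \<in> {0<..T} \<Longrightarrow> j \<in> {1..N} \<Longrightarrow>
      poly_curve_deriv {0<..T} (\<lambda>s. P s j) t (P' t j)"
proof -
  have "\<exists>P P'. \<forall>t\<in>{0<..T}. degree (P t) \<le> k \<and> degree (P' t) \<le> k \<and>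
    (\<forall>y\<in>{X (j - 1)<..<X j}. w t y = poly (P t) y) \<and> poly_curve_deriv {0<..T} P t (P' t)"
    if "j \<in> {1..N}" for j
    using that m w d
    by (intro poly_curve_of_pointwise)
      (auto simp: mesh_def Vh_def time_differentiable_def cell_def)
  then obtain P P' where PP: "\<And>j t. j \<in> {1..N} \<Longrightarrow> t \<in> {0<..T} \<Longrightarrow>
    degree (P j t) \<le> k \<and> degree (P' j t) \<le> k \<and>
    (\<forall>y\<in>{X (j - 1)<..<X j}. w t y = poly (P j t) y) \<and>
    poly_curve_deriv {0<..T} (P j) t (P' j t)"
    by metis
  have "time_deriv T w t y = poly (P' j t) y"
    if t: "t \<in> {0<..T}" and j: "j \<in> {1..N}" and y: "y \<in> {X (j - 1)<..<X j}" for t j y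
    unfolding time_deriv_def
  proof (rule vector_derivative_within)
    \<comment> \<open>\<open>vector_derivative\<close> returns the derivative only where it is
      unique, so \<open>t\<close> must be a limit point of the time interval; this includes the end
      point \<open>T\<close>.\<close>
    show "at t within {0<..T} \<noteq> bot"
      using t by (auto simp: trivial_limit_within islimpt_Ioc)
    have "((\<lambda>s. poly (P j s) y) has_real_derivative poly (P' j t) y) (at t within {0<..T})"
      by (rule poly_curve_deriv_poly) (use PP[OF j] t in auto)
    then have "((\<lambda>s. w s y) has_real_derivative poly (P' j t) y) (at t within {0<..T})"
      by (rule has_field_derivative_transform_within[OF _ zero_less_one t])
        (use PP[OF j] y in auto)
    then show "((\<lambda>s. w s y) has_vector_derivative poly (P' j t) y) (at t within {0<..T})"
      by (simp add: has_real_derivative_iff_has_vector_derivative)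
  qed
  then show thesis
    using PP by (intro that[of "\<lambda>t j. P j t" "\<lambda>t j. P' j t"]) (auto simp: piecewise_poly_def)
qed

lemma energy_has_derivative:
  fixes U U' V V' :: "real \<Rightarrow> nat \<Rightarrow> real poly"
  assumes m: "mesh a b N X" and t: "t \<in> D"
    and rep: "\<And>s. s \<in> D \<Longrightarrow> piecewise_poly N X (u s) (U s)"
      "\<And>s. s \<in> D \<Longrightarrow> piecewise_poly N X (v s) (V s)"
    and deg: "\<And>s j. s \<in> D \<Longrightarrow> j \<in> {1..N} \<Longrightarrow> degree (U s j) \<le> p \<and> degree (U' s j) \<le> p"
      "\<And>s j. s \<in> D \<Longrightarrow> j \<in> {1..N} \<Longrightarrow> degree (V s j) \<le> q \<and> degree (V' s j) \<le> q"
    and der: "\<And>j. j \<in> {1..N} \<Longrightarrow> poly_curve_deriv D (\<lambda>s. U s j) t (U' t j)"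
      "\<And>j. j \<in> {1..N} \<Longrightarrow> poly_curve_deriv D (\<lambda>s. V s j) t (V' t j)"
  shows "((\<lambda>s. energy a b (u s) (v s)) has_real_derivative
    2 * (\<Sum>j=1..N. integral {X (j - 1)..X j}
      (poly (pderiv (U' t j) * pderiv (U t j) + V' t j * V t j)))) (at t within D)"
proof -
  let ?Q = "\<lambda>j. pderiv (U' t j) * pderiv (U t j) + V' t j * V t j"
  let ?E = "\<lambda>j s. pderiv (U s j) * pderiv (U s j) + V s j * V s j"
  \<comment> \<open>A single generous bound covers the products from both components and from their
    derivatives.\<close>
  have deg_mult: "degree (P * Q) \<le> 2 * (p + q)"
    if "degree P \<le> p + q" "degree Q \<le> p + q" for P Q :: "real poly"
    by (rule order_trans[OF degree_mult_le]) (use that in simp)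
  have "((\<lambda>s. integral {X (j - 1)..X j} (poly (?E j s))) has_real_derivative
      2 * integral {X (j - 1)..X j} (poly (?Q j))) (at t within D)" if j: "j \<in> {1..N}" for j
  proof -
    let ?R = "pderiv (U' t j) * pderiv (U t j) + pderiv (U t j) * pderiv (U' t j)
      + (V' t j * V t j + V t j * V' t j)"
    have "poly_curve_deriv D (?E j) t ?R"
      by (intro poly_curve_deriv_add poly_curve_deriv_mult poly_curve_deriv_pderiv der j)
    then have "((\<lambda>s. integral {X (j - 1)..X j} (poly (?E j s))) has_real_derivative
        integral {X (j - 1)..X j} (poly ?R)) (at t within D)"
    proof (rule poly_curve_deriv_integral[where n = "2 * (p + q)"])
      have *: "degree (pderiv (U s j)) \<le> p + q \<and> degree (pderiv (U' s j)) \<le> p + q \<and>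
          degree (V s j) \<le> p + q \<and> degree (V' s j) \<le> p + q" if "s \<in> D" for s
        using deg(1)[OF that j] deg(2)[OF that j] by (auto simp: degree_pderiv)
      show "degree (?E j s) \<le> 2 * (p + q)" if "s \<in> D" for s
        using *[OF that] by (intro degree_add_le deg_mult) auto
      show "degree ?R \<le> 2 * (p + q)"
        using *[OF t] by (intro degree_add_le deg_mult) auto
    qed (rule t)
    \<comment> \<open>The two terms of each product rule coincide by commutativity; this is the
      factor 2 in the derivative.\<close>
    moreover have "?R = smult 2 (?Q j)"
      using smult_add_left[of 1 1 "?Q j"] by (simp add: algebra_simps)
    ultimately show ?thesis by (simp only: integral_poly_smult)
  qed
  then have "((\<lambda>s. \<Sum>j=1..N. integral {X (j - 1)..X j} (poly (?E j s))) has_real_derivative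
      2 * (\<Sum>j=1..N. integral {X (j - 1)..X j} (poly (?Q j)))) (at t within D)"
    unfolding sum_distrib_left by (rule DERIV_sum)
  then show ?thesis
    by (rule has_field_derivative_transform_within[OF _ zero_less_one t])
      (rule energy_eq_sum_cells(2)[OF m rep, symmetric])
qed

theorem theorem2p1:
  fixes a b T \<alpha> \<tau> \<beta> c :: real
    and N p q :: nat
    and X :: "nat \<Rightarrow> real"
    and u v :: "real \<Rightarrow> real \<Rightarrow> real"
  assumes "mesh a b N X"
    and "T > 0"
    and "p \<ge> 1" and "q \<ge> 1"
    and "0 \<le> \<alpha>" and "\<alpha> \<le> 1"
    and "c \<ge> 0" and "\<tau> \<ge> 0" and "\<beta> \<ge> 0"
    and "OF_EDG_solution N X T p q \<alpha> \<tau> \<beta> c u v"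
  shows "\<forall>t\<in>{0<..T}.
     energy a b (u t) (v t) =
       (\<Sum>j=1..N. integral (cell X j) (\<lambda>y. (deriv (u t) y)\<^sup>2 + (v t y)\<^sup>2)) \<and>
     (\<exists>D. ((\<lambda>s. energy a b (u s) (v s)) has_real_derivative D) (at t within {0<..T}) \<and> D \<le> 0)"
proof
  fix t assume t: "t \<in> {0<..T}"
  note m = \<open>mesh a b N X\<close> and sol = \<open>OF_EDG_solution N X T p q \<alpha> \<tau> \<beta> c u v\<close>
  have *: "\<forall>t\<in>{0<..T}. u t \<in> Vh N X p" "\<forall>t\<in>{0<..T}. v t \<in> Vh N X q"
    "time_differentiable N X T u" "time_differentiable N X T v"
    using sol by (auto simp: OF_EDG_solution_def)
  \<comment> \<open>The same polynomial families feed the derivative formula and the sign estimate,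
    so both speak of one sum.\<close>
  obtain U U' where
    U: "\<And>t. t \<in> {0<..T} \<Longrightarrow> piecewise_poly N X (u t) (U t)"
    "\<And>t. t \<in> {0<..T} \<Longrightarrow> piecewise_poly N X (time_deriv T u t) (U' t)"
    "\<And>t j. t \<in> {0<..T} \<Longrightarrow> j \<in> {1..N} \<Longrightarrow> degree (U t j) \<le> p \<and> degree (U' t j) \<le> p"
    "\<And>t j. t \<in> {0<..T} \<Longrightarrow> j \<in> {1..N} \<Longrightarrow>
      poly_curve_deriv {0<..T} (\<lambda>s. U s j) t (U' t j)"
    by (rule Vh_curve_representation[OF m *(1,3)]) blast
  obtain V V' where
    V: "\<And>t. t \<in> {0<..T} \<Longrightarrow> piecewise_poly N X (v t) (V t)"
    "\<And>t. t \<in> {0<..T} \<Longrightarrow> piecewise_poly N X (time_deriv T v t) (V' t)"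
    "\<And>t j. t \<in> {0<..T} \<Longrightarrow> j \<in> {1..N} \<Longrightarrow> degree (V t j) \<le> q \<and> degree (V' t j) \<le> q"
    "\<And>t j. t \<in> {0<..T} \<Longrightarrow> j \<in> {1..N} \<Longrightarrow>
      poly_curve_deriv {0<..T} (\<lambda>s. V s j) t (V' t j)"
    by (rule Vh_curve_representation[OF m *(2,4)]) blast
  have "((\<lambda>s. energy a b (u s) (v s)) has_real_derivative
    2 * (\<Sum>j=1..N. integral {X (j - 1)..X j}
      (poly (pderiv (U' t j) * pderiv (U t j) + V' t j * V t j)))) (at t within {0<..T})"
    by (rule energy_has_derivative[OF m t U(1) V(1) U(3) V(3) U(4)[OF t] V(4)[OF t]])
  moreover have "2 * (\<Sum>j=1..N. integral {X (j - 1)..X j}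
      (poly (pderiv (U' t j) * pderiv (U t j) + V' t j * V t j))) \<le> 0"
    using OF_EDG_energy_rate[OF m assms(3,4,7-9) sol t U(1)[OF t] _ V(1)[OF t] _ U(2)[OF t] V(2)[OF t]]
      U(3)[OF t] V(3)[OF t] by simp
  ultimately show "energy a b (u t) (v t) =
       (\<Sum>j=1..N. integral (cell X j) (\<lambda>y. (deriv (u t) y)\<^sup>2 + (v t y)\<^sup>2)) \<and>
     (\<exists>D. ((\<lambda>s. energy a b (u s) (v s)) has_real_derivative D) (at t within {0<..T}) \<and> D \<le> 0)"
    using energy_eq_sum_cells(1)[OF m U(1)[OF t] V(1)[OF t]] by blast
qed

end
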